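(* Let $n$ and $w$ be positive integers. There is no $\mathrm{CGW}(n,w;6)$ when $n$ is odd and $w \equiv 2 \pmod 3$.
   Context: For a positive integer $k$, let $\zeta_k = e^{2\pi\sqrt{-1}/k}$ and $\mathcal{U}_k = \{0\} \cup \{\zeta_k^j : 0 \le j \le k-1\}$. A $\mathrm{CGW}(n,w;k)$ (complex generalized weighing matrix of order $n$ and weight $w$) is an $n \times n$ matrix $W$ with entries in $\mathcal{U}_k$ such that $WW^{*} = wI_n$, where $W^*$ is the complex conjugate transpose. *)

theory Defs
  imports "Jordan_Normal_Form.Schur_Decomposition"
begin

definition zeta :: "nat \<Rightarrow> complex" where
  "zeta k = exp (2 * of_real pi * \<i> / of_nat k)"

definition U_set :: "nat \<Rightarrow> complex set" where
  "U_set k = {0} \<union> {zeta k ^ j | j. j \<le> k - 1}"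

text \<open>As a set of matrices; \<open>mat_adjoint\<close> is the conjugate transpose.
  Meaningful for \<open>k > 0\<close>, as the truncated \<open>k - 1\<close> is the intended bound only then.\<close>

definition CGW :: "nat \<Rightarrow> nat \<Rightarrow> nat \<Rightarrow> complex mat set" where
  "CGW n w k = {W \<in> carrier_mat n n.
     (\<forall>i<n. \<forall>j<n. W $$ (i, j) \<in> U_set k) \<and>
     W * mat_adjoint W = of_nat w \<cdot>\<^sub>m 1\<^sub>m n}"

end

theory Submission
  imports Defs "HOL-Number_Theory.Cong"
begin

text \<open>The entries of a \<open>CGW(n,w;6)\<close> are Eisenstein integers, hence so is its determinant \<open>d\<close>,
  and \<open>d * cnj d = w ^ n\<close>. A norm \<open>a\<^sup>2 + a b + b\<^sup>2 \<equiv> (a - b)\<^sup>2\<close> is never \<open>2\<close> modulo \<open>3\<close>,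
  whereas \<open>w ^ n \<equiv> 2\<close> for odd \<open>n\<close> and \<open>w \<equiv> 2\<close>.\<close>

text \<open>This is the ring of Eisenstein integers in the basis 1, \<open>zeta 6\<close>; with a
  primitive cube root of unity as second basis element the norm form would be
  \<open>a\<^sup>2 - a * b + b\<^sup>2\<close>.\<close>

definition Eisenstein :: "complex set" where
  "Eisenstein = {of_int a + of_int b * zeta 6 | a b. True}"

lemma zeta_6: "zeta 6 = Complex (1/2) (sqrt 3 / 2)"
proof -
  have "zeta 6 = cis (pi / 3)"
    unfolding zeta_def cis_conv_exp by (simp add: field_simps)
  then show ?thesis
    by (simp add: complex_eq_iff cos_60 sin_60)
qed

text \<open>\<open>zeta 6\<close> is a root of the sixth cyclotomic polynomial; this relation closes
  \<open>Eisenstein\<close> under multiplication.\<close>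

lemma zeta_6_squared: "zeta 6 * zeta 6 = zeta 6 - 1"
  by (simp add: zeta_6 complex_eq_iff)

lemma Eisenstein_of_int [simp]: "of_int a \<in> Eisenstein"
  unfolding Eisenstein_def by (force intro: exI[of _ a] exI[of _ 0])

lemma Eisenstein_0 [simp]: "0 \<in> Eisenstein"
  using Eisenstein_of_int[of 0] by simp

lemma Eisenstein_1 [simp]: "1 \<in> Eisenstein"
  using Eisenstein_of_int[of 1] by simp

lemma Eisenstein_zeta [simp]: "zeta 6 \<in> Eisenstein"
  unfolding Eisenstein_def by (force intro: exI[of _ 0] exI[of _ 1])

lemma Eisenstein_add: "x + y \<in> Eisenstein" if "x \<in> Eisenstein" "y \<in> Eisenstein"
proof -
  from that obtain a b c d where
    "x = of_int a + of_int b * zeta 6" "y = of_int c + of_int d * zeta 6"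
    unfolding Eisenstein_def by blast
  then have "x + y = of_int (a + c) + of_int (b + d) * zeta 6"
    by (simp add: algebra_simps)
  then show ?thesis unfolding Eisenstein_def by blast
qed

lemma Eisenstein_mult: "x * y \<in> Eisenstein" if "x \<in> Eisenstein" "y \<in> Eisenstein"
proof -
  from that obtain a b c d where
    "x = of_int a + of_int b * zeta 6" "y = of_int c + of_int d * zeta 6"
    unfolding Eisenstein_def by blast
  then have "x * y = of_int (a * c) + of_int (a * d + b * c) * zeta 6
      + of_int (b * d) * (zeta 6 * zeta 6)"
    by (simp add: algebra_simps)
  also have "\<dots> = of_int (a * c - b * d) + of_int (a * d + b * c + b * d) * zeta 6"
    unfolding zeta_6_squared by (simp add: algebra_simps)
  finally show ?thesis unfolding Eisenstein_def by blast
qed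

lemma Eisenstein_sum: "(\<And>i. i \<in> I \<Longrightarrow> f i \<in> Eisenstein) \<Longrightarrow> sum f I \<in> Eisenstein"
  by (induction I rule: infinite_finite_induct) (auto intro: Eisenstein_add)

lemma Eisenstein_prod: "(\<And>i. i \<in> I \<Longrightarrow> f i \<in> Eisenstein) \<Longrightarrow> prod f I \<in> Eisenstein"
  by (induction I rule: infinite_finite_induct) (auto intro: Eisenstein_mult)

lemma U_set_6_subset: "U_set 6 \<subseteq> Eisenstein"
proof -
  have "zeta 6 ^ j \<in> Eisenstein" for j
    by (induction j) (auto intro: Eisenstein_mult)
  then show ?thesis unfolding U_set_def by auto
qed

text \<open>The Leibniz formula writes the determinant as a signed sum of products of
  entries.\<close>

lemma Eisenstein_det:
  assumes "A \<in> carrier_mat n n" and "\<And>i j. i < n \<Longrightarrow> j < n \<Longrightarrow> A $$ (i, j) \<in> Eisenstein"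
  shows "det A \<in> Eisenstein"
  unfolding det_def'[OF assms(1)]
proof (intro Eisenstein_sum Eisenstein_mult Eisenstein_prod)
  fix p i assume "p \<in> {p. p permutes {0..<n}}" "i \<in> {0..<n}"
  then show "A $$ (i, p i) \<in> Eisenstein"
    using assms(2) permutes_in_image[of p "{0..<n}" i] by auto
\<comment> \<open>What remains is the sign of the permutation, which is an integer.\<close>
qed simp

text \<open>\<open>zeta 6\<close> and its conjugate have sum 1, giving the cross term, and product
  1, giving the last square.\<close>

lemma norm_Eisenstein:
  assumes "x \<in> Eisenstein"
  obtains a b :: int where "x * cnj x = of_int (a\<^sup>2 + a * b + b\<^sup>2)"
proof -
  from assms obtain a b where x: "x = of_int a + of_int b * zeta 6"
    unfolding Eisenstein_def by blast
  have "x * cnj x = of_int (a\<^sup>2 + a * b + b\<^sup>2)"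
    unfolding x zeta_6 by (simp add: complex_eq_iff power2_eq_square algebra_simps)
  then show thesis by (rule that)
qed

text \<open>The form has discriminant -3, so modulo 3 it degenerates to the square of a linear form,
  and 2 is not a square modulo 3.\<close>

lemma Eisenstein_norm_form_mod_3: "(a\<^sup>2 + a * b + b\<^sup>2) mod 3 \<noteq> (2 :: int)"
proof -
  have "a\<^sup>2 + a * b + b\<^sup>2 = (a - b)\<^sup>2 + 3 * (a * b)"
    by (simp add: power2_eq_square algebra_simps)
  then have "(a\<^sup>2 + a * b + b\<^sup>2) mod 3 = (a - b)\<^sup>2 mod 3"
    by (metis mod_mult_self2)
  also have "\<dots> = ((a - b) mod 3)\<^sup>2 mod 3"
    by (simp add: power_mod)
  also have "(a - b) mod 3 \<in> {0, 1, 2}" by auto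
  then have "((a - b) mod 3)\<^sup>2 mod 3 \<noteq> 2" by auto
  finally show ?thesis .
qed

lemma mat_adjoint_eq_map_transpose: "mat_adjoint A = map_mat conjugate (transpose_mat A)"
  by (intro eq_matI) (auto simp: mat_adjoint_def mat_of_rows_index)

text \<open>Transposition preserves the determinant, and conjugation, being a ring homomorphism,
  commutes with it.\<close>

lemma det_mat_adjoint:
  fixes A :: "complex mat"
  assumes "A \<in> carrier_mat n n"
  shows "det (mat_adjoint A) = cnj (det A)"
proof -
  interpret cnj: comm_ring_hom cnj by unfold_locales auto
  have "conjugate = cnj" by auto
  then show ?thesis
    using det_transpose[OF assms] by (simp add: mat_adjoint_eq_map_transpose)
qed

theorem proposition2p6:
  fixes n w :: nat
  assumes "n > 0" and "w > 0"
    and "odd n" and "w mod 3 = 2"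
  shows "\<not> (\<exists>W. W \<in> CGW n w 6)"
proof
  assume "\<exists>W. W \<in> CGW n w 6"
  then obtain W where W: "W \<in> carrier_mat n n"
    and entries: "\<And>i j. i < n \<Longrightarrow> j < n \<Longrightarrow> W $$ (i, j) \<in> U_set 6"
    and weighing: "W * mat_adjoint W = of_nat w \<cdot>\<^sub>m 1\<^sub>m n"
    unfolding CGW_def by auto
  have "det W \<in> Eisenstein"
    using W entries U_set_6_subset by (blast intro: Eisenstein_det)
  then obtain a b where ab: "det W * cnj (det W) = of_int (a\<^sup>2 + a * b + b\<^sup>2)"
    by (rule norm_Eisenstein)
  have "mat_adjoint W \<in> carrier_mat n n"
    using W by (simp add: mat_adjoint_eq_map_transpose)
  then have "det W * cnj (det W) = det (W * mat_adjoint W)"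
    using W by (simp add: det_mult det_mat_adjoint)
  \<comment> \<open>Casting through \<open>int\<close> lets injectivity of \<open>of_int\<close>
    turn the complex equation into one of integers.\<close>
  also have "\<dots> = of_int (int w ^ n)"
    by (simp add: weighing)
  finally have "int w ^ n = a\<^sup>2 + a * b + b\<^sup>2"
    unfolding ab of_int_eq_iff by simp
  moreover have "int w ^ n mod 3 = 2"
  proof -
    \<comment> \<open>With the representative -1 for the residue 2, the odd power is
      immediate.\<close>
    have "[int w = - 1] (mod 3)"
      using assms(4) unfolding cong_def by presburger
    then have "[int w ^ n = (- 1) ^ n] (mod 3)"
      by (rule cong_pow)
    then show ?thesis
      using assms(3) by (simp add: cong_def)
  qed
  ultimately show False
    using Eisenstein_norm_form_mod_3[of a b] by simp
qed

end
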